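(* Let $\beta_i=1-p_i$ for $i=1,\dots,r$. The following relation holds: $$\lim_{q\to1}K_{q,\vec{n}}^{\vec{p},\vec{\beta},N}(s)=K_{\vec{n}}^{\vec{p},N}(s),$$ where $K_{q,\vec{n}}^{\vec{p},\vec{\beta},N}(s)$ is the monic $q$-Kravchuk multiple orthogonal polynomial on the lattice $x(s)=\frac{q^s-1}{q-1}$ and $K_{\vec{n}}^{\vec{p},N}(s)$ is the monic multiple Kravchuk polynomial.
   Context: Let $q>0$, $q\neq1$, and let $x(s)=\frac{q^s-1}{q-1}$. "Polynomial on the lattice $x(s)$" means polynomial in the variable $x(s)$, and "monic of degree $m$" means leading term $x(s)^m$. Put $\bigtriangleup f(s)=f(s+1)-f(s)$, so $\bigtriangleup x(s-1/2)=q^{s-1/2}$. $[s]_q^{(k)}=\prod_{j=0}^{k-1}\frac{q^{s-j}-1}{q-1}$ for $k>0$, and $[s]_q^{(0)}=1$. The function $\Gamma_q$ is $\Gamma_q(s)=f(s;q)=(1-q)^{1-s}\frac{\prod_{k\ge0}(1-q^{k+1})}{\prod_{k\ge0}(1-q^{s+k})}$ for $0<q<1$, and $\Gamma_q(s)=q^{(s-1)(s-2)/2}f(s;q^{-1})$ for $q>1$. Also $[N]_q=q^{(1-N)/2}\frac{\Gamma_q(N+1)}{\Gamma_q(N)}=q^{(1-N)/2}\frac{q^N-1}{q-1}$ and $[N]_q!=\prod_{k=1}^N[k]_q$. Let $N\in\mathbb N$, let $\vec n=(n_1,\dots,n_r)\in\mathbb N^r$ be a multi-index (entries nonnegative integers)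 with $|\vec n|=n_1+\dots+n_r\le N$, and let $\vec p=(p_1,\dots,p_r)$ with $0<p_i<1$ and all $p_i$ different. For $p,\beta>0$ set $$\upsilon_q^{p,\beta,N}(s)=\frac{q^{\binom s2}[N]_q!\,p^s\beta^{N-s}}{\Gamma_q(s+1)\Gamma_q(N-s+1)}$$ if $s\in\mathbb R\setminus(\mathbb Z^-\cup\{N+1,N+2,\dots\})$, and $\upsilon_q^{p,\beta,N}(s)=0$ otherwise. For $\vec\beta=(\beta_1,\dots,\beta_r)$, the monic $q$-Kravchuk multiple orthogonal polynomial $K_{q,\vec n}^{\vec p,\vec\beta,N}(s)$ is the monic polynomial of degree $|\vec n|$ on $x(s)$ such that $$\sum_{s=0}^N K_{q,\vec n}^{\vec p,\vec\beta,N}(s)[s]_q^{(k)}\upsilon_q^{p_i,\beta_i,N}(s)\bigtriangleup x(s-1/2)=0,\quad 0\le k\le n_i-1,\ i=1,\dots,r.$$ It is a standing assumption that the multi-indices are normal, i.e. the monic polynomial of degree $|\vec n|$ satisfying these conditions exists and is unique. The multiple Kravchuk polynomial $K_{\vec n}^{\vec p,N}(x)$ is the unique monic polynomial in $x$ of degree $|\vec n|$ such that $$\sum_{x=0}^N K_{\vec n}^{\vec p,N}(x)\,(-x)_j\,\frac{N!\,p_i^x(1-p_i)^{N-x}}{\Gamma(x+1)\Gamma(N-x+1)}=0,\quad j=0,\dots,n_i-1,\ i=1,\dots,r,$$ where $(a)_j=a(a+1)\cdots(a+j-1)$ is the Pochhammer symbol. It is also given by $$K_{\vec n}^{\vec p,N}(x)=(-N)_{|\vec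 n|}\Big(\prod_{i=1}^rp_i^{n_i}\Big)\frac{\Gamma(x+1)\Gamma(N-x+1)}{N!}\left(\prod_{i=1}^r\Big(\frac{1-p_i}{p_i}\Big)^x\bigtriangledown^{n_i}\Big(\frac{p_i}{1-p_i}\Big)^x\right)\frac{(N-|\vec n|)!}{\Gamma(x+1)\Gamma(N-|\vec n|-x+1)},$$ with $\bigtriangledown f(x)=f(x)-f(x-1)$ and the product being a composition of operators acting on the function to its right. The limit is pointwise in $s$, with $N,\vec n,\vec p$ fixed. *)

theory Defs
  imports "HOL-Analysis.Analysis" "HOL-Computational_Algebra.Polynomial"
begin

definition q_lattice :: "real \<Rightarrow> real \<Rightarrow> real" where
  "q_lattice q s = (q powr s - 1) / (q - 1)"

definition forward_diff :: "(real \<Rightarrow> real) \<Rightarrow> real \<Rightarrow> real" where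
  "forward_diff f s = f (s + 1) - f s"

lemma forward_diff_q_lattice:
  assumes "0 < q" "q \<noteq> 1"
  shows "forward_diff (q_lattice q) (s - 1/2) = q powr (s - 1/2)"
proof -
  have "q powr (s - 1/2 + 1) = q * q powr (s - 1/2)"
    using assms by (simp only: powr_add powr_one) (simp add: mult.commute)
  then have "forward_diff (q_lattice q) (s - 1/2) = (q - 1) * q powr (s - 1/2) / (q - 1)"
    unfolding forward_diff_def q_lattice_def
    by (simp only: diff_divide_distrib [symmetric]) (simp add: algebra_simps)
  then show ?thesis
    using assms by simp
qed

definition q_falling :: "real \<Rightarrow> real \<Rightarrow> nat \<Rightarrow> real" where
  "q_falling q s k = (\<Prod>j<k. (q powr (s - real j) - 1) / (q - 1))"

definition q_Gamma_base :: "real \<Rightarrow> real \<Rightarrow> real" where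
  "q_Gamma_base q s =
     (1 - q) powr (1 - s) * (\<Prod>k. 1 - q ^ (k + 1)) / (\<Prod>k. 1 - q powr (s + real k))"

text \<open>Meaningful for positive \<open>q\<close> different from 1, and for \<open>s\<close> not in \<open>{0, -1, -2, \<dots>}\<close>,
  where the denominator of \<open>q_Gamma_base\<close> vanishes.\<close>

definition q_Gamma :: "real \<Rightarrow> real \<Rightarrow> real" where
  "q_Gamma q s =
     (if q < 1 then q_Gamma_base q s
      else q powr ((s - 1) * (s - 2) / 2) * q_Gamma_base (1 / q) s)"

text \<open>The symmetric bracket, which differs from \<open>q_lattice q N\<close> by a power of \<open>q\<close>.\<close>

definition q_bracket :: "real \<Rightarrow> nat \<Rightarrow> real" where
  "q_bracket q N = q powr ((1 - real N) / 2) * ((q ^ N - 1) / (q - 1))"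

definition q_fact :: "real \<Rightarrow> nat \<Rightarrow> real" where
  "q_fact q N = (\<Prod>k=1..N. q_bracket q k)"

definition q_kravchuk_weight :: "real \<Rightarrow> real \<Rightarrow> real \<Rightarrow> nat \<Rightarrow> real \<Rightarrow> real" where
  "q_kravchuk_weight q p \<beta> N s =
     (if s \<in> \<int> \<and> (s < 0 \<or> s > real N) then 0
      else q powr (s gchoose 2) * q_fact q N * p powr s * \<beta> powr (real N - s)
             / (q_Gamma q (s + 1) * q_Gamma q (real N - s + 1)))"

text \<open>Multi-indices and parameter vectors are functions on \<open>nat\<close> of which only the entries
  \<open>1, \<dots>, r\<close> are used. A polynomial \<open>P\<close> on the lattice is represented by
  \<open>P :: real poly\<close> in the variable \<open>q_lattice q s\<close>.\<close>

definition is_q_kravchuk ::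
  "real \<Rightarrow> nat \<Rightarrow> nat \<Rightarrow> (nat \<Rightarrow> nat) \<Rightarrow> (nat \<Rightarrow> real) \<Rightarrow> (nat \<Rightarrow> real) \<Rightarrow> real poly \<Rightarrow> bool" where
  "is_q_kravchuk q N r n p \<beta> P \<longleftrightarrow>
     degree P = (\<Sum>i=1..r. n i) \<and> lead_coeff P = 1 \<and>
     (\<forall>i\<in>{1..r}. \<forall>k<n i.
        (\<Sum>s=0..N. poly P (q_lattice q (real s)) * q_falling q (real s) k
            * q_kravchuk_weight q (p i) (\<beta> i) N (real s)
            * forward_diff (q_lattice q) (real s - 1/2)) = 0)"

definition q_kravchuk_normal ::
  "real \<Rightarrow> nat \<Rightarrow> nat \<Rightarrow> (nat \<Rightarrow> nat) \<Rightarrow> (nat \<Rightarrow> real) \<Rightarrow> (nat \<Rightarrow> real) \<Rightarrow> bool" where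
  "q_kravchuk_normal q N r n p \<beta> \<longleftrightarrow> (\<exists>!P. is_q_kravchuk q N r n p \<beta> P)"

definition q_kravchuk ::
  "real \<Rightarrow> nat \<Rightarrow> nat \<Rightarrow> (nat \<Rightarrow> nat) \<Rightarrow> (nat \<Rightarrow> real) \<Rightarrow> (nat \<Rightarrow> real) \<Rightarrow> real \<Rightarrow> real" where
  "q_kravchuk q N r n p \<beta> s = poly (THE P. is_q_kravchuk q N r n p \<beta> P) (q_lattice q s)"

definition is_kravchuk ::
  "nat \<Rightarrow> nat \<Rightarrow> (nat \<Rightarrow> nat) \<Rightarrow> (nat \<Rightarrow> real) \<Rightarrow> real poly \<Rightarrow> bool" where
  "is_kravchuk N r n p P \<longleftrightarrow>
     degree P = (\<Sum>i=1..r. n i) \<and> lead_coeff P = 1 \<and>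
     (\<forall>i\<in>{1..r}. \<forall>j<n i.
        (\<Sum>x=0..N. poly P (real x) * pochhammer (- real x) j
            * (fact N * p i ^ x * (1 - p i) ^ (N - x)
                / (Gamma (real x + 1) * Gamma (real N - real x + 1)))) = 0)"

definition kravchuk ::
  "nat \<Rightarrow> nat \<Rightarrow> (nat \<Rightarrow> nat) \<Rightarrow> (nat \<Rightarrow> real) \<Rightarrow> real \<Rightarrow> real" where
  "kravchuk N r n p x = poly (THE P. is_kravchuk N r n p P) x"

end

theory Submission
  imports Defs
begin

text \<open>As \<open>q \<rightarrow> 1\<close>, the linear system for the coefficients of the \<open>q\<close>-Kravchuk polynomial
  converges entrywise to the classical one, because \<open>q_Gamma q (s + 1)\<close> at a natural number \<open>s\<close> is a
  finite product of \<open>q\<close>-numbers. The classical homogeneous system is nonsingular: a polynomial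
  \<open>Q\<close> of degree below \<open>|n|\<close> orthogonal to everything is the image of a polynomial \<open>R\<close> of smaller
  degree under the raising operator of some \<open>i\<close> with \<open>n i > 0\<close>, and summation by parts shows that
  \<open>R\<close> solves the same problem for \<open>N - 1\<close> and the multi-index with \<open>n i\<close> lowered by one, so
  induction on \<open>|n|\<close> gives \<open>Q = 0\<close>. Coefficient vectors scaled to unit \<open>l1\<close>-norm have a
  convergent subsequence; its limit solves the classical homogeneous conditions, so its leading
  entry is nonzero, and undoing the scaling gives convergence to the monic classical polynomial.\<close>

subsection \<open>Nonsingularity of the classical system\<close>

text \<open>Subtracting the multiple of \<open>b d\<close> that cancels the leading term lowers the
  degree. A property that survives adding multiples of the \<open>b d\<close> can thus be proved
  along any family with one polynomial in each degree.\<close>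

lemma poly_graded_basis_induct [consumes 1, case_names degree zero add]:
  fixes b :: "nat \<Rightarrow> real poly"
  assumes "degree Q < m"
    and deg: "\<And>d. d < m \<Longrightarrow> degree (b d) = d \<and> b d \<noteq> 0"
    and zero: "P 0"
    and add: "\<And>Q a d. P Q \<Longrightarrow> d < m \<Longrightarrow> P (Q + smult a (b d))"
  shows "P Q"
  using assms(1)
proof (induction "degree Q" arbitrary: Q rule: less_induct)
  case less
  define d a where "d = degree Q" and "a = lead_coeff Q / lead_coeff (b d)"
  define Q' where "Q' = Q - smult a (b d)"
  have d: "d < m" "degree (b d) = d" "b d \<noteq> 0"
    using less.prems deg by (auto simp: d_def)
  have lc: "lead_coeff (b d) \<noteq> 0" using d(3) leading_coeff_0_iff by blast
  have "P Q'"
  proof (cases "Q' = 0")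
    case False
    have "degree Q' \<le> d"
      unfolding Q'_def using d by (intro degree_diff_le degree_smult_le[THEN order_trans]) (auto simp: d_def)
    moreover have "coeff Q' d = 0"
      using lc d unfolding Q'_def a_def d_def by simp
    ultimately have "degree Q' < d \<or> degree Q' = 0 \<and> d = 0"
      using False by (metis leading_coeff_0_iff le_neq_implies_less)
    then have "degree Q' < d"
      using False \<open>coeff Q' d = 0\<close> by (metis leading_coeff_0_iff)
    then show ?thesis using less d by (simp add: d_def)
  qed (simp add: zero)
  then have "P (Q' + smult a (b d))" using add d by blast
  then show ?case by (simp add: Q'_def)
qed

lemma degree_eqI_coeff:
  fixes b :: "real poly"
  assumes "degree b \<le> d" "coeff b d \<noteq> 0"
  shows "degree b = d \<and> b \<noteq> 0"
  using assms le_degree[of b d] by (auto intro: antisym)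

text \<open>\<open>raise_op N c R\<close> is \<open>N / w N\<close> times the backward difference of \<open>w (N - 1) * R\<close>,
  where \<open>w N x = (N choose x) * c ^ x\<close>.\<close>

definition raise_op :: "nat \<Rightarrow> real \<Rightarrow> real poly \<Rightarrow> real poly" where
  "raise_op N c R = [:real N, -1:] * R - smult (1 / c) ([:0, 1:] * (R \<circ>\<^sub>p [:-1, 1:]))"

lemma poly_raise_op:
  "poly (raise_op N c R) x = (real N - x) * poly R x - x * poly R (x - 1) / c"
  by (simp add: raise_op_def poly_pcompose algebra_simps)

lemma raise_op_add_smult:
  "raise_op N c (R + smult a S) = raise_op N c R + smult a (raise_op N c S)"
  by (rule poly_eq_poly_eq_iff[THEN iffD1], rule ext)
    (simp add: poly_raise_op algebra_simps add_divide_distrib)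

lemma raise_op_0 [simp]: "raise_op N c 0 = 0"
  by (simp add: raise_op_def)

lemma monom_pcompose_linear: "monom 1 d \<circ>\<^sub>p [:a, 1:] = ([:a, 1:] ^ d :: real poly)"
  by (induction d) (auto simp: monom_Suc pcompose_pCons monom_0 pcompose_1)

text \<open>The two terms contribute \<open>- 1\<close> and \<open>- 1 / c\<close> to the top
  coefficient; for positive \<open>c\<close> they cannot cancel.\<close>

lemma raise_op_monom:
  assumes "c > 0"
  shows "degree (raise_op N c (monom 1 d)) = Suc d \<and> raise_op N c (monom 1 d) \<noteq> 0"
proof (rule degree_eqI_coeff)
  have eq: "raise_op N c (monom 1 d) =
      [:real N, -1:] * monom 1 d - smult (1 / c) (pCons 0 ([:-1, 1:] ^ d))"
    by (simp add: raise_op_def monom_pcompose_linear)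
  have deg: "degree ([:-1, 1:] ^ d :: real poly) \<le> d"
    using degree_linear_power[of "-1::real" d] by simp
  have "degree ([:real N, -1:] * monom 1 d) \<le> Suc d"
    by (rule order_trans[OF degree_mult_le]) (simp add: degree_monom_eq)
  moreover have "degree (smult (1 / c) (pCons 0 ([:-1, 1:] ^ d))) \<le> Suc d"
    using deg by (intro degree_smult_le[THEN order_trans]) (simp add: degree_pCons_le)
  ultimately show "degree (raise_op N c (monom 1 d)) \<le> Suc d"
    unfolding eq by (intro degree_diff_le)
  have "coeff (raise_op N c (monom 1 d)) (Suc d) = - 1 - 1 / c"
    unfolding eq by (simp add: coeff_linear_poly_power)
  moreover have "- 1 - 1 / c < 0" using assms by (smt (verit) divide_pos_pos)
  ultimately show "coeff (raise_op N c (monom 1 d)) (Suc d) \<noteq> 0" by simp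
qed

text \<open>The constant 1 and the images of the monomials form a family with one polynomial in each
  degree, so \<open>Q\<close> is an image up to a constant. The disjunct \<open>R = 0\<close> covers
  \<open>M = 0\<close>.\<close>

lemma raise_op_decomposition:
  assumes "c > 0" "degree Q < Suc M"
  shows "\<exists>R a. Q = raise_op N c R + [:a:] \<and> (R = 0 \<or> degree R < M)"
proof -
  define b where "b d = (case d of 0 \<Rightarrow> 1 | Suc e \<Rightarrow> raise_op N c (monom 1 e))" for d
  have deg: "degree (b d) = d \<and> b d \<noteq> 0" for d
    using raise_op_monom[OF assms(1)] by (auto simp: b_def split: nat.split)
  show ?thesis
    using assms(2)
  proof (induction Q rule: poly_graded_basis_induct[where b = b])
    case zero
    show ?case by (rule exI[of _ 0], rule exI[of _ 0]) simp
  next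
    case (add Q t d)
    then obtain R a where Q: "Q = raise_op N c R + [:a:]" "R = 0 \<or> degree R < M" by blast
    show ?case
    proof (cases d)
      case 0
      then have "Q + smult t (b d) = raise_op N c R + [:a + t:]"
        by (simp add: Q b_def one_pCons)
      then show ?thesis using Q(2) by blast
    next
      case (Suc e)
      define R' where "R' = R + smult t (monom 1 e)"
      have "Q + smult t (b d) = raise_op N c R' + [:a:]"
        by (simp add: Q b_def Suc R'_def raise_op_add_smult algebra_simps)
      moreover have "degree R' < M"
        unfolding R'_def using Q(2) add(2) Suc
        by (intro degree_add_less order.strict_trans1[OF degree_smult_le]) (auto simp: degree_monom_eq)
      ultimately show ?thesis by blast
    qed
  qed (use deg in auto)
qed

text \<open>Absorption identities turn both terms of \<open>raise_op\<close> into the weight for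
  \<open>N\<close>, the second after a shift. The parameters \<open>c\<close> and \<open>c'\<close>
  are kept apart because an image under the operator of one index is tested against the weights of
  all indices.\<close>

lemma raise_op_sum_by_parts:
  fixes R T :: "real poly"
  shows "(\<Sum>x\<le>Suc N. real (Suc N choose x) * c ^ x * poly (raise_op (Suc N) c' R) (real x) * poly T (real x)) =
    real (Suc N) * (\<Sum>x\<le>N. real (N choose x) * c ^ x * poly R (real x) *
      poly (T - smult (c / c') (T \<circ>\<^sub>p [:1, 1:])) (real x))"
proof -
  define f where "f x = real (Suc N choose x) * (real (Suc N) - real x) * c ^ x * poly R (real x) * poly T (real x)" for x
  define g where "g x = real (Suc N choose x) * real x * c ^ x * poly R (real x - 1) * poly T (real x) / c'" for x
  have f: "f x = real (Suc N) * (real (N choose x) * c ^ x * poly R (real x) * poly T (real x))" if "x \<le> N" for x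
  proof -
    have "(Suc N - x) * (Suc N choose x) = Suc N * (N choose x)"
      using binomial_absorb_comp[of "Suc N" x] by simp
    then have "(real (Suc N) - real x) * real (Suc N choose x) = real (Suc N) * real (N choose x)"
      using that by (metis le_SucI of_nat_diff of_nat_mult)
    then show ?thesis by (simp add: f_def mult_ac)
  qed
  have g: "g (Suc x) = real (Suc N) * (real (N choose x) * c ^ x * poly R (real x) *
      (c / c' * poly T (1 + real x)))" for x
  proof -
    have "Suc x * (Suc N choose Suc x) = Suc N * (N choose x)"
      by (rule Suc_times_binomial)
    then have "real (Suc N choose Suc x) * real (Suc x) = real (Suc N) * real (N choose x)"
      by (metis of_nat_mult mult.commute)
    moreover have "g (Suc x) = real (Suc N choose Suc x) * real (Suc x) *
        (c ^ x * poly R (real x) * (c / c' * poly T (1 + real x)))"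
      by (simp add: g_def mult_ac)
    ultimately show ?thesis by (simp add: mult_ac)
  qed
  have "(\<Sum>x\<le>Suc N. real (Suc N choose x) * c ^ x * poly (raise_op (Suc N) c' R) (real x) * poly T (real x))
      = (\<Sum>x\<le>Suc N. f x) - (\<Sum>x\<le>Suc N. g x)"
    unfolding sum_subtractf[symmetric]
    by (intro sum.cong refl) (simp add: f_def g_def poly_raise_op algebra_simps)
  \<comment> \<open>The boundary terms vanish: \<open>f\<close> contains the factor
    \<open>Suc N - x\<close>, and \<open>g\<close> the factor \<open>x\<close>.\<close>
  also have "(\<Sum>x\<le>Suc N. f x) = (\<Sum>x\<le>N. f x)" by (simp add: f_def)
  also have "(\<Sum>x\<le>Suc N. g x) = (\<Sum>x\<le>N. g (Suc x))"
    by (subst sum.atMost_Suc_shift) (simp add: g_def)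
  also have "(\<Sum>x\<le>N. f x) - (\<Sum>x\<le>N. g (Suc x)) = real (Suc N) * (\<Sum>x\<le>N. real (N choose x) * c ^ x * poly R (real x) *
      poly (T - smult (c / c') (T \<circ>\<^sub>p [:1, 1:])) (real x))"
    unfolding sum_subtractf[symmetric] sum_distrib_left
    by (intro sum.cong refl) (simp only: f g atMost_iff, simp add: poly_pcompose algebra_simps)
  finally show ?thesis .
qed

text \<open>The top coefficient is \<open>1 - \<rho>\<close>. With
  \<open>\<rho> = c i / c i0\<close> this covers the indices other than \<open>i0\<close>, whose
  test degrees survive summation by parts.\<close>

lemma degree_monom_minus_shift:
  assumes "\<rho> \<noteq> 1"
  shows "degree (monom 1 d - smult \<rho> (monom 1 d \<circ>\<^sub>p [:1, 1:])) = d \<and>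
    monom 1 d - smult \<rho> (monom 1 d \<circ>\<^sub>p [:1, 1:]) \<noteq> (0 :: real poly)"
proof (rule degree_eqI_coeff)
  show "degree (monom 1 d - smult \<rho> (monom 1 d \<circ>\<^sub>p [:1, 1:])) \<le> d"
    unfolding monom_pcompose_linear
    by (intro degree_diff_le degree_smult_le[THEN order_trans])
      (auto simp: degree_monom_eq degree_linear_power)
  show "coeff (monom 1 d - smult \<rho> (monom 1 d \<circ>\<^sub>p [:1, 1:])) d \<noteq> 0"
    unfolding monom_pcompose_linear using assms by (simp add: coeff_linear_poly_power)
qed

text \<open>The case of ratio 1: the leading terms cancel and the next coefficient is
  \<open>- (d + 1)\<close>, so exactly one test degree is lost. This is why only the entry at
  \<open>i0\<close> drops.\<close>

lemma degree_monom_diff_shift: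
  "degree (monom 1 (Suc d) - monom 1 (Suc d) \<circ>\<^sub>p [:1, 1:] :: real poly) = d \<and>
    monom 1 (Suc d) - monom 1 (Suc d) \<circ>\<^sub>p [:1, 1:] \<noteq> (0 :: real poly)"
proof (rule degree_eqI_coeff)
  show "degree (monom 1 (Suc d) - monom 1 (Suc d) \<circ>\<^sub>p [:1, 1:] :: real poly) \<le> d"
    unfolding monom_pcompose_linear
  proof (rule degree_le, intro allI impI)
    fix i assume "d < i"
    then consider "i = Suc d" | "i > Suc d" by linarith
    then show "coeff (monom 1 (Suc d) - [:1, 1:] ^ Suc d :: real poly) i = 0"
    proof cases
      case 1
      then show ?thesis by (simp add: coeff_linear_poly_power del: power_Suc)
    next
      case 2
      then have "coeff ([:1, 1:] ^ Suc d :: real poly) i = 0"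
        by (intro coeff_eq_0) (simp add: degree_linear_power del: power_Suc)
      then show ?thesis using 2 by (simp del: power_Suc)
    qed
  qed
  show "coeff (monom 1 (Suc d) - monom 1 (Suc d) \<circ>\<^sub>p [:1, 1:] :: real poly) d \<noteq> 0"
    unfolding monom_pcompose_linear by (simp add: coeff_linear_poly_power del: power_Suc)
qed

text \<open>Up to factors independent of \<open>x\<close>, these are binomial weights with odds
  \<open>c i\<close>. Distinct odds keep all test degrees for indices other than \<open>i0\<close>,
  and \<open>sum n I \<le> N\<close> lets \<open>N\<close> drop together with the total order in
  each induction step.\<close>

lemma multiple_kravchuk_orthogonal_imp_zero:
  fixes c :: "'i \<Rightarrow> real" and n :: "'i \<Rightarrow> nat"
  assumes "finite I" "inj_on c I" "\<And>i. i \<in> I \<Longrightarrow> c i > 0"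
    and "sum n I \<le> N" "degree Q < sum n I"
    and "\<And>i T. i \<in> I \<Longrightarrow> degree T < n i \<Longrightarrow>
      (\<Sum>x\<le>N. real (N choose x) * c i ^ x * poly Q (real x) * poly T (real x)) = 0"
  shows "Q = 0"
  using assms(4-6)
proof (induction "sum n I" arbitrary: n N Q)
  case 0
  then show ?case by simp
next
  case (Suc M)
  note orth = Suc.prems(3)
  obtain i0 where i0: "i0 \<in> I" "n i0 > 0"
    using Suc.hyps(2) by (metis gr0I sum.neutral Zero_not_Suc)
  define n' where "n' = n(i0 := n i0 - 1)"
  have sum_n': "sum n' I = M"
    using Suc.hyps(2) i0 assms(1) by (simp add: n'_def sum.remove[of I i0])
  obtain N' where N: "N = Suc N'" using Suc.hyps(2) Suc.prems(1) by (cases N) auto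
  have c0: "c i0 > 0" using assms(3) i0 by blast
  obtain R a where Q: "Q = raise_op N (c i0) R + [:a:]" and R: "R = 0 \<or> degree R < M"
    using raise_op_decomposition[OF c0, of Q M N] Suc.hyps(2) Suc.prems(2) by metis
  \<comment> \<open>Testing against 1 with equal parameters gives 0, as 1 equals its own shift. The
    constant \<open>a\<close> times a positive total mass is then 0 as well.\<close>
  have "(\<Sum>x\<le>N. real (N choose x) * c i0 ^ x * poly (raise_op N (c i0) R) (real x) * poly 1 (real x)) = 0"
    unfolding N raise_op_sum_by_parts using c0 by (simp add: pcompose_1)
  moreover have "(\<Sum>x\<le>N. real (N choose x) * c i0 ^ x * poly Q (real x) * poly 1 (real x)) = 0"
    using orth[of i0 1] i0 by simp
  ultimately have "a * (\<Sum>x\<le>N. real (N choose x) * c i0 ^ x) = 0"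
    by (simp add: Q algebra_simps sum.distrib sum_distrib_left)
  moreover have "(\<Sum>x\<le>N. real (N choose x) * c i0 ^ x) > 0"
    using c0 by (intro sum_pos) auto
  ultimately have "a = 0" by simp
  then have Q': "Q = raise_op (Suc N') (c i0) R" using Q N by simp
  have shift: "(\<Sum>x\<le>N'. real (N' choose x) * c i ^ x * poly R (real x) *
      poly (T - smult (c i / c i0) (T \<circ>\<^sub>p [:1, 1:])) (real x)) = 0"
    if "i \<in> I" "degree T < n i" for i T
    using orth[OF that] unfolding Q' N raise_op_sum_by_parts by simp
  have orth_R: "(\<Sum>x\<le>N'. real (N' choose x) * c i ^ x * poly R (real x) * poly T (real x)) = 0"
    if i: "i \<in> I" "degree T < n' i" for i T
  proof -
    \<comment> \<open>Test polynomials that arise from summation by parts, one in each degree; for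
      \<open>i0\<close> the source has degree \<open>Suc d\<close>, still below \<open>n i0\<close>
      when \<open>d < n' i0\<close>.\<close>
    define b :: "nat \<Rightarrow> real poly" where "b d =
      (let T = monom 1 (if i = i0 then Suc d else d) in T - smult (c i / c i0) (T \<circ>\<^sub>p [:1, 1:]))" for d
    have deg: "degree (b d) = d \<and> b d \<noteq> 0" for d
    proof (cases "i = i0")
      case True
      then show ?thesis using c0 degree_monom_diff_shift[of d] by (simp add: b_def Let_def)
    next
      case False
      then have "c i / c i0 \<noteq> 1" using assms(2) i0 i c0 by (auto simp: inj_on_def)
      then show ?thesis using False degree_monom_minus_shift[of "c i / c i0" d] by (simp add: b_def Let_def)
    qed
    have orth_b: "(\<Sum>x\<le>N'. real (N' choose x) * c i ^ x * poly R (real x) * poly (b d) (real x)) = 0"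
      if "d < n' i" for d
      unfolding b_def Let_def using that i(1)
      by (intro shift) (auto simp: n'_def degree_monom_eq split: if_splits)
    show ?thesis using i(2)
    proof (induction T rule: poly_graded_basis_induct[where b = b])
      case (add Q t d)
      have "(\<Sum>x\<le>N'. real (N' choose x) * c i ^ x * poly R (real x) * poly (Q + smult t (b d)) (real x))
        = (\<Sum>x\<le>N'. real (N' choose x) * c i ^ x * poly R (real x) * poly Q (real x))
        + t * (\<Sum>x\<le>N'. real (N' choose x) * c i ^ x * poly R (real x) * poly (b d) (real x))"
        by (simp add: sum.distrib sum_distrib_left algebra_simps)
      then show ?case using add orth_b by simp
    qed (use deg in auto)
  qed
  have "R = 0"
  proof (rule ccontr)
    assume "R \<noteq> 0"
    then have "degree R < sum n' I" using R sum_n' by simp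
    moreover have "sum n' I \<le> N'" using sum_n' Suc.prems(1) Suc.hyps(2) N by simp
    ultimately have "R = 0" using Suc.hyps(1)[of n' N' R] sum_n' orth_R by blast
    with \<open>R \<noteq> 0\<close> show False by simp
  qed
  then show ?case by (simp add: Q')
qed

subsection \<open>The limit of the weights\<close>

text \<open>The denominator is a tail of the numerator's convergent product, so the quotient leaves
  the first \<open>s\<close> factors; cancelling requires the tail product to be nonzero.\<close>

lemma q_Gamma_base_Suc:
  assumes "0 < q" "q < 1"
  shows "q_Gamma_base q (real s + 1) = (\<Prod>k<s. (1 - q ^ Suc k) / (1 - q))"
proof -
  define f :: "nat \<Rightarrow> real" where "f k = 1 - q ^ (k + 1)" for k
  have "summable (\<lambda>k. q * q ^ k)"
    using assms by (intro summable_mult summable_geometric) auto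
  then have "abs_convergent_prod f"
    using assms by (intro summable_imp_abs_convergent_prod) (simp add: f_def)
  then have conv: "convergent_prod f" by (rule abs_convergent_prod_imp_convergent_prod)
  have nz: "f k \<noteq> 0" for k
    using assms power_Suc_less_one[of q k] by (simp add: f_def)
  have "(\<Prod>k. f (k + s)) \<noteq> 0"
    using conv nz by (intro prodinf_nonzero) auto
  moreover have "prodinf f = (\<Prod>k. f (k + s)) * (\<Prod>k<s. f k)"
    using conv nz by (intro prodinf_split_initial_segment) auto
  moreover have "(\<lambda>k. 1 - q powr (real s + 1 + real k)) = (\<lambda>k. f (k + s))"
  proof
    fix k
    have "q powr real (k + s + 1) = q ^ (k + s + 1)" using assms by (simp only: powr_realpow)
    then show "1 - q powr (real s + 1 + real k) = f (k + s)" by (simp add: f_def add_ac)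
  qed
  moreover have "(1 - q) powr (1 - (real s + 1)) = 1 / (1 - q) ^ s"
    using assms by (simp add: powr_minus powr_realpow divide_inverse)
  ultimately have "q_Gamma_base q (real s + 1) = (\<Prod>k<s. f k) / (1 - q) ^ s"
    unfolding q_Gamma_base_def f_def[symmetric] by simp
  then show ?thesis by (simp add: prod_dividef f_def)
qed

text \<open>For \<open>q > 1\<close>, each factor in base \<open>1 / q\<close> is the one in base
  \<open>q\<close> divided by \<open>q ^ k\<close>, and the prefactor in \<open>q_Gamma\<close>
  restores the product of these powers. Having one formula on both sides of 1 makes the limit
  two-sided.\<close>

lemma q_Gamma_Suc:
  assumes "0 < q" "q \<noteq> 1"
  shows "q_Gamma q (real s + 1) = (\<Prod>k<s. (q ^ Suc k - 1) / (q - 1))"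
proof (cases "q < 1")
  case True
  have "(1 - q ^ Suc k) / (1 - q) = (q ^ Suc k - 1) / (q - 1)" for k
    by (metis minus_diff_eq minus_divide_divide)
  then show ?thesis
    using True assms by (simp add: q_Gamma_def q_Gamma_base_Suc del: power_Suc)
next
  case False
  then have q: "q > 1" using assms by simp
  have "(\<Prod>k<s. (1 - (1 / q) ^ Suc k) / (1 - 1 / q)) = (\<Prod>k<s. (q ^ Suc k - 1) / (q - 1) / q ^ k)"
    using q by (intro prod.cong refl) (simp add: field_simps)
  also have "\<dots> = (\<Prod>k<s. (q ^ Suc k - 1) / (q - 1)) / (\<Prod>k<s. q ^ k)"
    by (rule prod_dividef)
  also have "(\<Prod>k<s. q ^ k) = q powr (real s * (real s - 1) / 2)"
  proof (induction s)
    case (Suc s)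
    have "real (Suc s) * (real (Suc s) - 1) / 2 = real s * (real s - 1) / 2 + real s"
      by (simp add: field_simps)
    then have "q powr (real (Suc s) * (real (Suc s) - 1) / 2) = q powr (real s * (real s - 1) / 2) * q ^ s"
      using q by (simp only: powr_add powr_realpow)
    then show ?case using Suc by simp
  qed (use q in simp)
  finally show ?thesis
    using q q_Gamma_base_Suc[of "1 / q" s] by (simp add: q_Gamma_def)
qed

text \<open>The lattice is the difference quotient of \<open>q powr s\<close> at
  \<open>q = 1\<close>, so its limit is the derivative there.\<close>

lemma tendsto_q_lattice: "((\<lambda>q. q_lattice q s) \<longlongrightarrow> s) (at 1)"
proof -
  have "((\<lambda>q::real. q powr s) has_real_derivative s * 1 powr (s - 1)) (at 1)"
    by (rule has_real_derivative_powr) simp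
  then show ?thesis
    by (simp add: has_field_derivative_iff q_lattice_def)
qed

lemma eventually_at_1_real: "\<forall>\<^sub>F q :: real in at 1. 0 < q \<and> q \<noteq> 1"
  by (intro eventually_conj order_tendstoD(1)[OF tendsto_ident_at] eventually_neq_at_within) simp

lemma tendsto_q_number: "((\<lambda>q. (q ^ k - 1) / (q - 1)) \<longlongrightarrow> real k) (at (1 :: real))"
proof (rule Lim_transform_eventually[OF tendsto_q_lattice])
  show "\<forall>\<^sub>F q in at 1. q_lattice q (real k) = (q ^ k - 1) / (q - 1)"
    using eventually_at_1_real by eventually_elim (simp add: q_lattice_def powr_realpow)
qed

lemma tendsto_q_Gamma: "((\<lambda>q. q_Gamma q (real s + 1)) \<longlongrightarrow> fact s) (at 1)"
proof (rule Lim_transform_eventually)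
  show "\<forall>\<^sub>F q in at 1. (\<Prod>k<s. (q ^ Suc k - 1) / (q - 1)) = q_Gamma q (real s + 1)"
    using eventually_at_1_real by eventually_elim (simp add: q_Gamma_Suc)
  have "((\<lambda>q. \<Prod>k<s. (q ^ Suc k - 1) / (q - 1)) \<longlongrightarrow> (\<Prod>k<s. real (Suc k))) (at 1)"
    by (intro tendsto_prod tendsto_q_number)
  also have "(\<Prod>k<s. real (Suc k)) = fact s"
    by (simp add: fact_prod_Suc atLeast0LessThan)
  finally show "((\<lambda>q. \<Prod>k<s. (q ^ Suc k - 1) / (q - 1)) \<longlongrightarrow> fact s) (at (1::real))" .
qed

lemma tendsto_q_powr_1: "((\<lambda>q::real. q powr a) \<longlongrightarrow> 1) (at 1)"
proof -
  have "((\<lambda>q::real. q powr a) \<longlongrightarrow> 1 powr a) (at 1)"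
    by (intro tendsto_intros) simp
  then show ?thesis by simp
qed

lemma tendsto_q_fact: "((\<lambda>q. q_fact q N) \<longlongrightarrow> fact N) (at 1)"
proof -
  have "((\<lambda>q. q_fact q N) \<longlongrightarrow> (\<Prod>k=1..N. 1 * real k)) (at 1)"
    unfolding q_fact_def q_bracket_def
    by (intro tendsto_prod tendsto_mult tendsto_q_powr_1 tendsto_q_number)
  then show ?thesis by (simp add: fact_prod)
qed

lemma tendsto_q_falling: "((\<lambda>q. q_falling q s k) \<longlongrightarrow> (\<Prod>j<k. s - real j)) (at 1)"
  unfolding q_falling_def using tendsto_q_lattice unfolding q_lattice_def by (intro tendsto_prod)

lemma tendsto_forward_diff_q_lattice:
  "((\<lambda>q. forward_diff (q_lattice q) (s - 1/2)) \<longlongrightarrow> 1) (at 1)"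
proof (rule Lim_transform_eventually[OF tendsto_q_powr_1])
  show "\<forall>\<^sub>F q in at 1. q powr (s - 1/2) = forward_diff (q_lattice q) (s - 1/2)"
    using eventually_at_1_real by eventually_elim (simp add: forward_diff_q_lattice)
qed

lemma tendsto_q_kravchuk_weight:
  assumes "s \<le> N" "p > 0" "\<beta> > 0"
  shows "((\<lambda>q. q_kravchuk_weight q p \<beta> N (real s)) \<longlongrightarrow> real (N choose s) * p ^ s * \<beta> ^ (N - s)) (at 1)"
proof -
  have "((\<lambda>q. q powr (real s gchoose 2) * q_fact q N * p powr real s * \<beta> powr real (N - s)
      / (q_Gamma q (real s + 1) * q_Gamma q (real (N - s) + 1))) \<longlongrightarrow>
      1 * fact N * p powr real s * \<beta> powr real (N - s) / (fact s * fact (N - s))) (at 1)"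
    by (intro tendsto_intros tendsto_q_powr_1 tendsto_q_fact tendsto_q_Gamma) simp
  \<comment> \<open>Both Gamma arguments must be a natural number plus one, which
    \<open>s \<le> N\<close> provides; it also excludes the zero branch of the weight.\<close>
  moreover have "real N - real s = real (N - s)" using assms(1) by simp
  ultimately show ?thesis
    unfolding q_kravchuk_weight_def using assms by (simp add: powr_realpow binomial_fact del: of_nat_diff)
qed

subsection \<open>Passing to the limit in a linear system\<close>

text \<open>Bolzano-Weierstrass, refining the subsequence one coordinate at a time.\<close>

lemma bounded_coeffs_convergent_subseq:
  fixes f :: "nat \<Rightarrow> nat \<Rightarrow> real"
  assumes "\<And>k j. j < m \<Longrightarrow> \<bar>f k j\<bar> \<le> B"
  shows "\<exists>r g. strict_mono (r :: nat \<Rightarrow> nat) \<and> (\<forall>j<m. (\<lambda>k. f (r k) j) \<longlonglongrightarrow> g j)"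
  using assms
proof (induction m)
  case 0
  show ?case by (rule exI[of _ id]) (simp add: strict_mono_def)
next
  case (Suc m)
  then obtain r g where r: "strict_mono (r :: nat \<Rightarrow> nat)" "\<And>j. j < m \<Longrightarrow> (\<lambda>k. f (r k) j) \<longlonglongrightarrow> g j"
    by (metis less_SucI)
  have "f (r k) m \<in> {-B..B}" for k using Suc.prems[of m "r k"] by auto
  then have "\<forall>k. f (r k) m \<in> {-B..B}" by blast
  then obtain l r' where "strict_mono (r' :: nat \<Rightarrow> nat)" "((\<lambda>k. f (r k) m) \<circ> r') \<longlonglongrightarrow> l"
    by (rule seq_compactE[OF compact_imp_seq_compact[OF compact_Icc]])
  then have r': "strict_mono r'" "(\<lambda>k. f (r (r' k)) m) \<longlonglongrightarrow> l" by (simp_all add: o_def)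
  have "(\<lambda>k. f (r (r' k)) j) \<longlonglongrightarrow> (g(m := l)) j" if "j < Suc m" for j
  proof (cases "j = m")
    case False
    then show ?thesis using LIMSEQ_subseq_LIMSEQ[OF r(2)[of j] r'(1)] that by (simp add: o_def)
  qed (use r' in simp)
  moreover have "strict_mono (\<lambda>k. r (r' k))"
    using strict_mono_o[OF r(1) r'(1)] by (simp add: o_def)
  ultimately show ?case
    by (intro exI[of _ "\<lambda>k. r (r' k)"] exI[of _ "g(m := l)"]) simp
qed

text \<open>Compactness replaces continuity of the inverse matrix; no bound on the solutions
  \<open>c k\<close> is assumed. Nonsingularity means that a solution of the limit system with last
  entry 0 vanishes.\<close>

lemma normalized_solution_limit:
  fixes A :: "nat \<Rightarrow> 'e \<Rightarrow> nat \<Rightarrow> real"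
  assumes A: "\<And>e j. e \<in> E \<Longrightarrow> j \<le> m \<Longrightarrow> (\<lambda>k. A k e j) \<longlonglongrightarrow> A' e j"
    and sol: "\<And>k e. e \<in> E \<Longrightarrow> (\<Sum>j\<le>m. A k e j * c k j) = 0"
    and normalized: "\<And>k. c k m = 1"
    and nonsingular: "\<And>d. (\<And>e. e \<in> E \<Longrightarrow> (\<Sum>j\<le>m. A' e j * d j) = 0) \<Longrightarrow> d m = 0 \<Longrightarrow>
      (\<And>j. j \<le> m \<Longrightarrow> d j = 0)"
  obtains r c' where "strict_mono (r :: nat \<Rightarrow> nat)" "c' m = 1"
    "\<And>e. e \<in> E \<Longrightarrow> (\<Sum>j\<le>m. A' e j * c' j) = 0"
    "\<And>j. j \<le> m \<Longrightarrow> (\<lambda>k. c (r k) j) \<longlonglongrightarrow> c' j"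
proof -
  define S where "S k = (\<Sum>j\<le>m. \<bar>c k j\<bar>)" for k
  have S: "\<bar>c k j\<bar> \<le> S k" if "j \<le> m" for k j
    unfolding S_def using that by (intro member_le_sum) auto
  have S_pos: "S k > 0" for k using S[of m k] normalized[of k] by simp
  have "\<bar>c k j / S k\<bar> \<le> 1" if "j < Suc m" for k j
    using S[of j k] S_pos[of k] that by simp
  then obtain r d where r: "strict_mono (r :: nat \<Rightarrow> nat)"
    and d: "\<And>j. j \<le> m \<Longrightarrow> (\<lambda>k. c (r k) j / S (r k)) \<longlonglongrightarrow> d j"
    using bounded_coeffs_convergent_subseq[of "Suc m" "\<lambda>k j. c k j / S k" 1]
    unfolding less_Suc_eq_le by blast
  have d_sol: "(\<Sum>j\<le>m. A' e j * d j) = 0" if "e \<in> E" for e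
  proof -
    have "(\<lambda>k. A (r k) e j) \<longlonglongrightarrow> A' e j" if "j \<le> m" for j
      using LIMSEQ_subseq_LIMSEQ[OF A[OF \<open>e \<in> E\<close> that] r] by (simp add: o_def)
    then have "(\<lambda>k. \<Sum>j\<le>m. A (r k) e j * (c (r k) j / S (r k))) \<longlonglongrightarrow> (\<Sum>j\<le>m. A' e j * d j)"
      by (intro tendsto_sum tendsto_mult d) auto
    moreover have "(\<Sum>j\<le>m. A (r k) e j * (c (r k) j / S (r k))) = 0" for k
      using sol[OF that, of "r k"] by (simp flip: sum_divide_distrib)
    ultimately show ?thesis by (simp add: LIMSEQ_const_iff)
  qed
  \<comment> \<open>The unit norm passes to the limit, so \<open>d\<close> is not zero.\<close>
  have "(\<lambda>k. \<Sum>j\<le>m. \<bar>c (r k) j / S (r k)\<bar>) \<longlonglongrightarrow> (\<Sum>j\<le>m. \<bar>d j\<bar>)"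
    by (intro tendsto_sum tendsto_rabs d) auto
  moreover have "(\<Sum>j\<le>m. \<bar>c k j / S k\<bar>) = 1" for k
  proof -
    have "(\<Sum>j\<le>m. \<bar>c k j / S k\<bar>) = S k / S k"
      using S_pos[of k] by (subst (2) S_def) (simp add: sum_divide_distrib)
    then show ?thesis using S_pos[of k] by simp
  qed
  ultimately have d_norm: "(\<Sum>j\<le>m. \<bar>d j\<bar>) = 1" by (simp add: LIMSEQ_const_iff)
  have dm: "d m \<noteq> 0"
  proof
    assume "d m = 0"
    then have "\<And>j. j \<le> m \<Longrightarrow> d j = 0" using nonsingular d_sol by blast
    with d_norm show False by simp
  qed
  show ?thesis
  proof (rule that[OF r, of "\<lambda>j. d j / d m"])
    show "(\<Sum>j\<le>m. A' e j * (d j / d m)) = 0" if "e \<in> E" for e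
      using d_sol[OF that] by (simp flip: sum_divide_distrib)
    show "(\<lambda>k. c (r k) j) \<longlonglongrightarrow> d j / d m" if "j \<le> m" for j
    proof -
      \<comment> \<open>Dividing by the scaled last entry cancels \<open>S k\<close>, because
        \<open>c k m = 1\<close>.\<close>
      have "c k j / S k / (c k m / S k) = c k j" for k
        using S_pos[of k] normalized[of k] by simp
      then show ?thesis using tendsto_divide[OF d[OF that] d[OF order_refl] dm] by simp
    qed
  qed (use dm in simp)
qed

subsection \<open>The limit of the polynomials\<close>

lemma poly_eq_sum_coeffs:
  fixes P :: "real poly"
  assumes "degree P \<le> m"
  shows "poly P x = (\<Sum>j\<le>m. coeff P j * x ^ j)"
  unfolding poly_altdef using assms
  by (intro sum.mono_neutral_left) (auto simp: coeff_eq_0)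

text \<open>Reads an orthogonality sum as a linear equation in the coefficients of \<open>P\<close>,
  with moments as matrix entries. The nodes \<open>y\<close> are lattice values for the
  \<open>q\<close>-system and integers for the classical one.\<close>

lemma sum_moments_eq_sum_poly:
  fixes P :: "real poly"
  assumes "degree P \<le> m"
  shows "(\<Sum>j\<le>m. (\<Sum>s\<in>X. y s ^ j * w s) * coeff P j) = (\<Sum>s\<in>X. poly P (y s) * w s)"
proof -
  have "(\<Sum>j\<le>m. (\<Sum>s\<in>X. y s ^ j * w s) * coeff P j) = (\<Sum>j\<le>m. \<Sum>s\<in>X. coeff P j * y s ^ j * w s)"
    by (simp add: sum_distrib_left mult_ac)
  also have "\<dots> = (\<Sum>s\<in>X. \<Sum>j\<le>m. coeff P j * y s ^ j * w s)" by (rule sum.swap)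
  finally show ?thesis by (simp add: poly_eq_sum_coeffs[OF assms] sum_distrib_right)
qed

lemma coeff_sum_monom: "coeff (\<Sum>j\<le>m. monom (d j) j) i = (if i \<le> m then d i else 0)"
  by (simp add: coeff_sum)

lemma degree_sum_monom_le: "degree (\<Sum>j\<le>m. monom (d j) j) \<le> m"
  by (rule degree_le) (simp add: coeff_sum_monom)

text \<open>The Pochhammer symbol at \<open>- x\<close> is \<open>(-1) ^ k\<close> times a falling
  factorial, and a global sign does not affect vanishing. In this form the conditions are the limits
  of the \<open>q\<close>-conditions.\<close>

lemma is_kravchuk_altdef:
  "is_kravchuk N r n p P \<longleftrightarrow>
     degree P = (\<Sum>i=1..r. n i) \<and> lead_coeff P = 1 \<and>
     (\<forall>i\<in>{1..r}. \<forall>k<n i. (\<Sum>x=0..N. poly P (real x) * ((\<Prod>l<k. real x - real l) *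
        (real (N choose x) * p i ^ x * (1 - p i) ^ (N - x)))) = 0)"
proof -
  have "(\<Sum>x=0..N. poly P (real x) * pochhammer (- real x) k *
      (fact N * p i ^ x * (1 - p i) ^ (N - x) / (Gamma (real x + 1) * Gamma (real N - real x + 1)))) =
      (-1) ^ k * (\<Sum>x=0..N. poly P (real x) * ((\<Prod>l<k. real x - real l) *
        (real (N choose x) * p i ^ x * (1 - p i) ^ (N - x))))" for i k
    unfolding sum_distrib_left
  proof (rule sum.cong)
    fix x assume "x \<in> {0..N}"
    then have x: "x \<le> N" by simp
    have "pochhammer (- real x) k = (\<Prod>l<k. (-1) * (real x - real l))"
      by (simp add: pochhammer_prod atLeast0LessThan)
    then have poch: "pochhammer (- real x) k = (-1) ^ k * (\<Prod>l<k. real x - real l)"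
      by (simp only: prod.distrib prod_constant card_lessThan)
    have "Gamma (real N - real x + 1) = fact (N - x)"
      using Gamma_fact[of "N - x", where ?'a = real] x by (simp add: add_ac)
    moreover have "Gamma (real x + 1) = fact x"
      using Gamma_fact[of x, where ?'a = real] by (simp add: add_ac)
    ultimately show "poly P (real x) * pochhammer (- real x) k *
      (fact N * p i ^ x * (1 - p i) ^ (N - x) / (Gamma (real x + 1) * Gamma (real N - real x + 1))) =
      (-1) ^ k * (poly P (real x) * ((\<Prod>l<k. real x - real l) *
        (real (N choose x) * p i ^ x * (1 - p i) ^ (N - x))))"
      using x by (simp add: poch binomial_fact)
  qed simp
  then show ?thesis by (simp add: is_kravchuk_def)
qed

text \<open>Dividing the weight by \<open>(1 - p i) ^ N\<close> passes to the odds
  \<open>c i\<close>, which are injective in \<open>p i\<close>. The falling factorials contain one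
  polynomial in each degree, so they reach every test polynomial of degree below
  \<open>n i\<close>.\<close>

lemma falling_orthogonal_imp_zero:
  fixes N r :: nat and n :: "nat \<Rightarrow> nat" and p :: "nat \<Rightarrow> real"
  assumes "(\<Sum>i=1..r. n i) \<le> N" "\<And>i. i \<in> {1..r} \<Longrightarrow> 0 < p i \<and> p i < 1" "inj_on p {1..r}"
    and orth: "\<And>i k. i \<in> {1..r} \<Longrightarrow> k < n i \<Longrightarrow>
      (\<Sum>x=0..N. poly Q (real x) * ((\<Prod>l<k. real x - real l) *
        (real (N choose x) * p i ^ x * (1 - p i) ^ (N - x)))) = 0"
    and "Q = 0 \<or> degree Q < (\<Sum>i=1..r. n i)"
  shows "Q = 0"
proof (cases "Q = 0")
  case False
  define c where "c i = p i / (1 - p i)" for i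
  define ff :: "nat \<Rightarrow> real poly" where "ff k = (\<Prod>l<k. [:- real l, 1:])" for k
  have ff_deg: "degree (ff k) = k \<and> ff k \<noteq> 0" for k
    by (simp add: ff_def degree_prod_eq_sum_degree)
  have poly_ff: "poly (ff k) x = (\<Prod>l<k. x - real l)" for k x
    by (simp add: ff_def poly_prod)
  have c: "(1 - p i) ^ N * c i ^ x = p i ^ x * (1 - p i) ^ (N - x)" if "i \<in> {1..r}" "x \<le> N" for i x
    using assms(2)[OF that(1)] that(2) by (simp add: c_def power_divide power_diff)
  have orth_ff: "(\<Sum>x\<le>N. real (N choose x) * c i ^ x * poly Q (real x) * poly (ff k) (real x)) = 0"
    if i: "i \<in> {1..r}" "k < n i" for i k
  proof -
    have "(1 - p i) ^ N * (\<Sum>x\<le>N. real (N choose x) * c i ^ x * poly Q (real x) * poly (ff k) (real x))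
      = (\<Sum>x\<le>N. real (N choose x) * ((1 - p i) ^ N * c i ^ x) * poly Q (real x) * poly (ff k) (real x))"
      by (simp add: sum_distrib_left mult_ac)
    also have "\<dots> = (\<Sum>x=0..N. poly Q (real x) * ((\<Prod>l<k. real x - real l) *
        (real (N choose x) * p i ^ x * (1 - p i) ^ (N - x))))"
      unfolding atLeast0AtMost using c[OF i(1)] by (intro sum.cong refl) (simp add: poly_ff mult_ac)
    also have "\<dots> = 0" by (rule orth[OF i])
    finally show ?thesis using assms(2)[OF i(1)] by simp
  qed
  show ?thesis
  proof (rule multiple_kravchuk_orthogonal_imp_zero)
    show "inj_on c {1..r}"
    proof (rule inj_onI)
      fix i j assume ij: "i \<in> {1..r}" "j \<in> {1..r}" "c i = c j"
      then have "p i = p j"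
        using assms(2)[OF ij(1)] assms(2)[OF ij(2)] by (simp add: c_def frac_eq_eq algebra_simps)
      then show "i = j" using inj_onD[OF assms(3)] ij(1,2) by blast
    qed
    show "c i > 0" if "i \<in> {1..r}" for i using assms(2)[OF that] by (simp add: c_def)
    show "degree Q < sum n {1..r}" using assms(5) False by simp
    show "(\<Sum>x\<le>N. real (N choose x) * c i ^ x * poly Q (real x) * poly T (real x)) = 0"
      if "i \<in> {1..r}" "degree T < n i" for i T
      using that(2)
    proof (induction T rule: poly_graded_basis_induct[where b = ff])
      case (add T t d)
      have "(\<Sum>x\<le>N. real (N choose x) * c i ^ x * poly Q (real x) * poly (T + smult t (ff d)) (real x))
        = (\<Sum>x\<le>N. real (N choose x) * c i ^ x * poly Q (real x) * poly T (real x))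
        + t * (\<Sum>x\<le>N. real (N choose x) * c i ^ x * poly Q (real x) * poly (ff d) (real x))"
        by (simp add: sum.distrib sum_distrib_left algebra_simps)
      then show ?case using add orth_ff[OF that(1)] by simp
    qed (use ff_deg in auto)
  qed (use assms(1) in simp_all)
qed

lemma is_kravchuk_unique:
  assumes "(\<Sum>i=1..r. n i) \<le> N" "\<And>i. i \<in> {1..r} \<Longrightarrow> 0 < p i \<and> p i < 1" "inj_on p {1..r}"
    and P: "is_kravchuk N r n p P" and P': "is_kravchuk N r n p P'"
  shows "P' = P"
proof -
  let ?m = "\<Sum>i=1..r. n i"
  have deg: "degree P = ?m" "degree P' = ?m" "coeff P ?m = 1" "coeff P' ?m = 1"
    using P P' by (auto simp: is_kravchuk_def)
  have "P' - P = 0"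
  proof (rule falling_orthogonal_imp_zero[OF assms(1-3)])
    have "degree (P' - P) \<le> ?m" using deg by (intro degree_diff_le) auto
    then show "P' - P = 0 \<or> degree (P' - P) < ?m"
      using deg by (metis coeff_diff diff_self le_neq_implies_less leading_coeff_0_iff)
  qed (use P P' in \<open>simp_all add: is_kravchuk_altdef left_diff_distrib sum_subtractf\<close>)
  then show ?thesis by simp
qed

text \<open>Turns the failure of a limit into a sequence, so that the subsequence argument applies.
  Points are picked within \<open>1 / (k + 1)\<close> of \<open>a\<close>.\<close>

lemma frequently_at_imp_sequence:
  fixes a :: "'a :: metric_space"
  assumes "\<exists>\<^sub>F x in at a. P x"
  shows "\<exists>X :: nat \<Rightarrow> 'a. (\<forall>k. P (X k)) \<and> filterlim X (at a) sequentially"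
proof -
  have "\<exists>x. x \<noteq> a \<and> dist x a < 1 / real (Suc k) \<and> P x" for k
    using assms unfolding frequently_def eventually_at
    using zero_less_divide_1_iff[of "real (Suc k)"] by auto
  then obtain X where X: "\<And>k. X k \<noteq> a" "\<And>k. dist (X k) a < 1 / real (Suc k)" "\<And>k. P (X k)"
    by metis
  have "(\<lambda>k. dist (X k) a) \<longlonglongrightarrow> 0"
    by (rule tendsto_sandwich[OF _ _ tendsto_const LIMSEQ_inverse_real_of_nat])
      (use X(2) in \<open>auto intro!: always_eventually less_imp_le simp: inverse_eq_divide\<close>)
  then have "X \<longlonglongrightarrow> a" by (rule tendsto_dist_iff[THEN iffD2])
  then have "filterlim X (at a) sequentially"
    using X(1) by (simp add: filterlim_at)
  with X(3) show ?thesis by blast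
qed

theorem proposition4p1:
  fixes N r :: nat and n :: "nat \<Rightarrow> nat" and p \<beta> :: "nat \<Rightarrow> real" and s :: real
  assumes "r \<ge> 1"
    and "(\<Sum>i=1..r. n i) \<le> N"
    and "\<And>i. i \<in> {1..r} \<Longrightarrow> 0 < p i \<and> p i < 1"
    and "inj_on p {1..r}"
    and "\<And>i. i \<in> {1..r} \<Longrightarrow> \<beta> i = 1 - p i"
    and "\<forall>\<^sub>F q in at 1. q_kravchuk_normal q N r n p \<beta>"
  shows "((\<lambda>q. q_kravchuk q N r n p \<beta> s) \<longlongrightarrow> kravchuk N r n p s) (at 1)"
proof (rule ccontr)
  assume "\<not> ?thesis"
  then obtain \<epsilon> where \<epsilon>: "\<epsilon> > 0"
    "\<exists>\<^sub>F q in at 1. dist (q_kravchuk q N r n p \<beta> s) (kravchuk N r n p s) \<ge> \<epsilon>"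
    unfolding tendsto_iff not_all not_imp not_eventually not_less by blast
  \<comment> \<open>Normality holds near 1, so the bad points \<open>q\<close> can be chosen with a
    unique \<open>q\<close>-polynomial.\<close>
  have "\<exists>\<^sub>F q in at 1. dist (q_kravchuk q N r n p \<beta> s) (kravchuk N r n p s) \<ge> \<epsilon> \<and>
      q_kravchuk_normal q N r n p \<beta>"
    using frequently_eventually_frequently[OF \<epsilon>(2) assms(6)] by simp
  from frequently_at_imp_sequence[OF this] obtain X :: "nat \<Rightarrow> real" where
      far_normal: "\<And>k. dist (q_kravchuk (X k) N r n p \<beta> s) (kravchuk N r n p s) \<ge> \<epsilon> \<and>
      q_kravchuk_normal (X k) N r n p \<beta>" and X_lim: "filterlim X (at 1) sequentially"
    by blast
  note X = conjunct1[OF far_normal] conjunct2[OF far_normal] X_lim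
  define m where "m = (\<Sum>i=1..r. n i)"
  \<comment> \<open>Equations are indexed by the weight and the test degree; \<open>W\<close> and
    \<open>W'\<close> collect all factors other than the polynomial value.\<close>
  define E where "E = {(i, k). i \<in> {1..r} \<and> k < n i}"
  define W where "W q = (\<lambda>(i, k) x. q_falling q (real x) k * q_kravchuk_weight q (p i) (\<beta> i) N (real x) *
    forward_diff (q_lattice q) (real x - 1/2))" for q
  define W' where "W' = (\<lambda>(i, k) x. (\<Prod>l<k. real x - real l) *
    (real (N choose x) * p i ^ x * (1 - p i) ^ (N - x)))"
  define P where "P k = (THE P. is_q_kravchuk (X k) N r n p \<beta> P)" for k
  have P: "is_q_kravchuk (X k) N r n p \<beta> (P k)" for k
    unfolding P_def using X(2)[of k] unfolding q_kravchuk_normal_def by (rule theI')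
  have P_deg: "degree (P k) = m" and P_lead: "coeff (P k) m = 1" for k
    using P[of k] by (auto simp: is_q_kravchuk_def m_def)
  have W: "(\<lambda>k. W (X k) e x) \<longlonglongrightarrow> W' e x" if e: "e \<in> E" and x: "x \<le> N" for e x
  proof -
    obtain i k where ik: "e = (i, k)" "i \<in> {1..r}" using e by (auto simp: E_def)
    have "((\<lambda>q. W q e x) \<longlongrightarrow> (\<Prod>l<k. real x - real l) *
        (real (N choose x) * p i ^ x * \<beta> i ^ (N - x)) * 1) (at 1)"
      unfolding W_def ik(1) prod.case
      using x assms(3)[OF ik(2)] assms(5)[OF ik(2)]
      by (intro tendsto_mult tendsto_q_falling tendsto_q_kravchuk_weight tendsto_forward_diff_q_lattice) auto
    then have "((\<lambda>q. W q e x) \<longlongrightarrow> W' e x) (at 1)"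
      using assms(5)[OF ik(2)] by (simp add: W'_def ik(1))
    then show ?thesis by (rule filterlim_compose[OF _ X(3)])
  qed
  have lattice: "(\<lambda>k. q_lattice (X k) y) \<longlonglongrightarrow> y" for y
    by (rule filterlim_compose[OF tendsto_q_lattice X(3)])
  obtain \<rho> c where \<rho>: "strict_mono (\<rho> :: nat \<Rightarrow> nat)" and c_lead: "c m = 1"
    and c_sol: "\<And>e. e \<in> E \<Longrightarrow> (\<Sum>j\<le>m. (\<Sum>x\<in>{0..N}. real x ^ j * W' e x) * c j) = 0"
    and c_lim: "\<And>j. j \<le> m \<Longrightarrow> (\<lambda>k. coeff (P (\<rho> k)) j) \<longlonglongrightarrow> c j"
  proof (rule normalized_solution_limit)
    show "(\<lambda>k. \<Sum>x\<in>{0..N}. q_lattice (X k) (real x) ^ j * W (X k) e x) \<longlonglongrightarrow>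
      (\<Sum>x\<in>{0..N}. real x ^ j * W' e x)" if "e \<in> E" for e j
      using that by (intro tendsto_sum tendsto_mult tendsto_power lattice W) auto
    show "(\<Sum>j\<le>m. (\<Sum>x\<in>{0..N}. q_lattice (X k) (real x) ^ j * W (X k) e x) * coeff (P k) j) = 0"
      if "e \<in> E" for k e
      using P[of k] that P_deg[of k]
      by (subst sum_moments_eq_sum_poly) (auto simp: is_q_kravchuk_def E_def W_def mult.assoc)
    show "coeff (P k) m = 1" for k by (rule P_lead)
    \<comment> \<open>A vector with last entry 0 that solves the limit system gives a polynomial
      that is zero or of degree below \<open>m\<close>, to which classical nonsingularity
      applies.\<close>
    fix d :: "nat \<Rightarrow> real" and j
    assume d: "\<And>e. e \<in> E \<Longrightarrow> (\<Sum>j\<le>m. (\<Sum>x\<in>{0..N}. real x ^ j * W' e x) * d j) = 0" "d m = 0" and j: "j \<le> m"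
    define Q where "Q = (\<Sum>j\<le>m. monom (d j) j)"
    have Q: "degree Q \<le> m" "\<And>j. j \<le> m \<Longrightarrow> coeff Q j = d j"
      by (simp_all add: Q_def degree_sum_monom_le coeff_sum_monom)
    have "Q = 0"
    proof (rule falling_orthogonal_imp_zero[OF assms(2-4)])
      show "Q = 0 \<or> degree Q < (\<Sum>i=1..r. n i)"
        using Q d(2) unfolding m_def[symmetric]
        by (metis le_neq_implies_less leading_coeff_0_iff)
      show "(\<Sum>x=0..N. poly Q (real x) * ((\<Prod>l<k. real x - real l) *
          (real (N choose x) * p i ^ x * (1 - p i) ^ (N - x)))) = 0"
        if ik: "i \<in> {1..r}" "k < n i" for i k
        using d(1)[of "(i, k)"] ik Q sum_moments_eq_sum_poly[OF Q(1), of real "W' (i, k)" "{0..N}"]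
        by (simp add: E_def W'_def)
    qed
    then show "d j = 0" using Q(2)[OF j] by simp
  qed blast
  \<comment> \<open>The limit vector supplies existence of the classical polynomial; uniqueness then
    identifies \<open>P'\<close> with the one selected in \<open>kravchuk\<close>.\<close>
  define P' where "P' = (\<Sum>j\<le>m. monom (c j) j)"
  have P': "degree P' \<le> m" "\<And>j. j \<le> m \<Longrightarrow> coeff P' j = c j"
    by (simp_all add: P'_def degree_sum_monom_le coeff_sum_monom)
  have P'_deg: "degree P' = m" using P' c_lead le_degree[of P' m] by simp
  have "is_kravchuk N r n p P'"
    unfolding is_kravchuk_altdef
  proof (intro conjI ballI allI impI)
    fix i k assume ik: "i \<in> {1..r}" "k < n i"
    show "(\<Sum>x=0..N. poly P' (real x) * ((\<Prod>l<k. real x - real l) *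
        (real (N choose x) * p i ^ x * (1 - p i) ^ (N - x)))) = 0"
      using c_sol[of "(i, k)"] ik P' sum_moments_eq_sum_poly[OF P'(1), of real "W' (i, k)" "{0..N}"]
      by (simp add: E_def W'_def)
  qed (use P' P'_deg c_lead in \<open>simp_all add: m_def\<close>)
  then have kravchuk: "kravchuk N r n p s = poly P' s"
    unfolding kravchuk_def using is_kravchuk_unique[OF assms(2-4)] by (subst the_equality) auto
  have "(\<lambda>k. \<Sum>j\<le>m. coeff (P (\<rho> k)) j * q_lattice (X (\<rho> k)) s ^ j) \<longlonglongrightarrow> (\<Sum>j\<le>m. c j * s ^ j)"
    by (intro tendsto_sum tendsto_mult tendsto_power c_lim
        LIMSEQ_subseq_LIMSEQ[OF lattice \<rho>, unfolded o_def]) auto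
  then have "(\<lambda>k. q_kravchuk (X (\<rho> k)) N r n p \<beta> s) \<longlonglongrightarrow> kravchuk N r n p s"
    using P' P_deg by (simp add: kravchuk q_kravchuk_def P_def[symmetric] poly_eq_sum_coeffs[where m = m])
  then have "\<forall>\<^sub>F k in sequentially. dist (q_kravchuk (X (\<rho> k)) N r n p \<beta> s) (kravchuk N r n p s) < \<epsilon>"
    using \<epsilon>(1) by (rule tendstoD)
  then obtain k where "dist (q_kravchuk (X (\<rho> k)) N r n p \<beta> s) (kravchuk N r n p s) < \<epsilon>"
    by (auto simp: eventually_sequentially)
  with X(1)[of "\<rho> k"] show False by simp
qed

end
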